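(* Let $b\ge0$ be a locally integrable function on $\mathbb{R}^n$, $0<\beta<1$, $0\le\alpha<n$, $0<\alpha+\beta<n$ and $b\in\dot\Lambda_\beta(\mathbb{R}^n)$. Suppose that $\Phi,\Psi$ are Young functions, $\Phi\in\mathcal{Y}$, and there is a constant $C>0$ such that $t^{-\frac{\alpha+\beta}{n}}\Phi^{-1}(t)\le C\,\Psi^{-1}(t)$ for all $t>0$. Then $[b,M_\alpha]$ is bounded from $L^\Phi(\mathbb{R}^n)$ to $WL^\Psi(\mathbb{R}^n)$.
   Context: A Young function is a convex, left-continuous function $\Phi:[0,\infty)\to[0,\infty]$ with $\lim_{r\to0+}\Phi(r)=\Phi(0)=0$ and $\lim_{r\to\infty}\Phi(r)=\infty$. $\mathcal{Y}$ is the set of Young functions with $0<\Phi(r)<\infty$ for all $0<r<\infty$. For a Young function, $\Phi^{-1}(s)=\inf\{r\ge0:\Phi(r)>s\}$. The Orlicz space $L^\Phi(\mathbb{R}^n)$ is the set of $f\in L^1_{\rm loc}(\mathbb{R}^n)$ with $\int_{\mathbb{R}^n}\Phi(k|f(x)|)\,dx<\infty$ for some $k>0$, with norm $\|f\|_{L^\Phi}=\inf\{\lambda>0:\int_{\mathbb{R}^n}\Phi(|f(x)|/\lambda)\,dx\le1\}$. The weak Orlicz space $WL^\Phi(\mathbb{R}^n)$ is the set of $f\in L^1_{\rm loc}(\mathbb{R}^n)$ with $\|f\|_{WL^\Phi}<\infty$, where $\|f\|_{WL^\Phi}=\inf\{\lambda>0:\sup_{t>0}\Phi(t)\,|\{x\in\mathbb{R}^n:|f(x)|/\lambda>t\}|\le1\}$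 ($|E|$ is Lebesgue measure; $\infty\cdot0=0$). For $0\le\alpha<n$, $M_\alpha f(x)=\sup_{B\ni x}|B|^{-1+\frac{\alpha}{n}}\int_B|f(y)|\,dy$, the supremum being over all balls $B\subset\mathbb{R}^n$ containing $x$. The (nonlinear) commutator is $[b,M_\alpha](f)(x)=b(x)M_\alpha(f)(x)-M_\alpha(bf)(x)$. An operator $T$ is bounded from $X$ to $Y$ if there is a constant $C$ with $\|Tf\|_Y\le C\|f\|_X$ for all $f\in X$. For $0<\beta<1$, $b\in\dot\Lambda_\beta(\mathbb{R}^n)$ (Lipschitz space) means there is a constant $C$ with $|b(x)-b(y)|\le C|x-y|^\beta$ for all $x,y\in\mathbb{R}^n$. *)

theory Defs
  imports "HOL-Analysis.Analysis"
begin

text \<open>Functions on \<open>[0,\<infinity>)\<close> are represented by functions on \<open>real\<close> whose values at negative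
  arguments are irrelevant.\<close>

definition young_function :: "(real \<Rightarrow> ennreal) \<Rightarrow> bool" where
  "young_function \<Phi> \<longleftrightarrow>
     (\<forall>x\<ge>0. \<forall>y\<ge>0. \<forall>u\<in>{0..1}.
        \<Phi> ((1 - u) * x + u * y) \<le> ennreal (1 - u) * \<Phi> x + ennreal u * \<Phi> y) \<and>
     (\<forall>r>0. (\<Phi> \<longlongrightarrow> \<Phi> r) (at_left r)) \<and>
     \<Phi> 0 = 0 \<and> (\<Phi> \<longlongrightarrow> 0) (at_right 0) \<and>
     (\<Phi> \<longlongrightarrow> \<infinity>) at_top"

definition young_class_Y :: "(real \<Rightarrow> ennreal) set" where
  "young_class_Y = {\<Phi>. young_function \<Phi> \<and> (\<forall>r>0. 0 < \<Phi> r \<and> \<Phi> r < \<infinity>)}"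

text \<open>For a Young function and real \<open>s\<close> the set below is nonempty (as \<open>\<Phi>\<close> tends to \<open>\<infinity>\<close>) and bounded
  below, so the real infimum is the true one.\<close>

definition young_inverse :: "(real \<Rightarrow> ennreal) \<Rightarrow> real \<Rightarrow> real" where
  "young_inverse \<Phi> s = Inf {r. 0 \<le> r \<and> ennreal s < \<Phi> r}"

text \<open>Functions produced by the maximal operator may be infinite on a null set, so local
  integrability and the weak Orlicz space are formulated for extended-real-valued functions.\<close>

definition L1_loc :: "('a::euclidean_space \<Rightarrow> ereal) set" where
  "L1_loc = {g. g \<in> borel_measurable lebesgue \<and>
     (\<forall>K. compact K \<longrightarrow> (\<integral>\<^sup>+x\<in>K. e2ennreal \<bar>g x\<bar> \<partial>lebesgue) < \<infinity>)}"

definition orlicz_space :: "(real \<Rightarrow> ennreal) \<Rightarrow> ('a::euclidean_space \<Rightarrow> real) set" where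
  "orlicz_space \<Phi> = {f. (\<lambda>x. ereal (f x)) \<in> L1_loc \<and>
     (\<exists>k>0. (\<integral>\<^sup>+x. \<Phi> (k * \<bar>f x\<bar>) \<partial>lebesgue) < \<infinity>)}"

definition orlicz_norm :: "(real \<Rightarrow> ennreal) \<Rightarrow> ('a::euclidean_space \<Rightarrow> real) \<Rightarrow> ennreal" where
  "orlicz_norm \<Phi> f =
     Inf {ennreal l | l. 0 < l \<and> (\<integral>\<^sup>+x. \<Phi> (\<bar>f x\<bar> / l) \<partial>lebesgue) \<le> 1}"

definition weak_orlicz_norm :: "(real \<Rightarrow> ennreal) \<Rightarrow> ('a::euclidean_space \<Rightarrow> ereal) \<Rightarrow> ennreal" where
  "weak_orlicz_norm \<Phi> g =
     Inf {ennreal l | l. 0 < l \<and>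
       (SUP t\<in>{0<..}. \<Phi> t * emeasure lebesgue {x. \<bar>g x\<bar> / ereal l > ereal t}) \<le> 1}"

definition weak_orlicz_space :: "(real \<Rightarrow> ennreal) \<Rightarrow> ('a::euclidean_space \<Rightarrow> ereal) set" where
  "weak_orlicz_space \<Phi> = {g \<in> L1_loc. weak_orlicz_norm \<Phi> g < \<infinity>}"

definition frac_maximal :: "real \<Rightarrow> ('a::euclidean_space \<Rightarrow> real) \<Rightarrow> 'a \<Rightarrow> ennreal" where
  "frac_maximal \<alpha> f x =
     (SUP (c, r) \<in> {(c, r). 0 < r \<and> x \<in> ball c r}.
        ennreal (measure lebesgue (ball c r) powr (- 1 + \<alpha> / DIM('a))) *
        (\<integral>\<^sup>+y\<in>ball c r. ennreal \<bar>f y\<bar> \<partial>lebesgue))"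

text \<open>In \<open>ereal\<close> one has \<open>\<infinity> - \<infinity> = \<infinity>\<close>, so an indeterminate difference can only enlarge the
  weak Orlicz norm of the commutator.\<close>

definition max_commutator ::
    "real \<Rightarrow> ('a::euclidean_space \<Rightarrow> real) \<Rightarrow> ('a \<Rightarrow> real) \<Rightarrow> 'a \<Rightarrow> ereal" where
  "max_commutator \<alpha> b f x =
     ereal (b x) * enn2ereal (frac_maximal \<alpha> f x)
       - enn2ereal (frac_maximal \<alpha> (\<lambda>y. b y * f y) x)"

definition bounded_operator ::
    "'f set \<Rightarrow> ('f \<Rightarrow> ennreal) \<Rightarrow> 'g set \<Rightarrow> ('g \<Rightarrow> ennreal) \<Rightarrow> ('f \<Rightarrow> 'g) \<Rightarrow> bool" where
  "bounded_operator X normX Y normY T \<longleftrightarrow>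
     (\<exists>C\<ge>0. \<forall>f\<in>X. T f \<in> Y \<and> normY (T f) \<le> ennreal C * normX f)"

definition lipschitz_space :: "real \<Rightarrow> ('a::euclidean_space \<Rightarrow> real) set" where
  "lipschitz_space \<beta> = {b. \<exists>C. \<forall>x y. \<bar>b x - b y\<bar> \<le> C * norm (x - y) powr \<beta>}"

end

theory Submission
  imports Defs
begin

text \<open>
  Put \<open>\<gamma> = \<alpha> + \<beta>\<close>. The Lipschitz condition gives \<open>|[b, M\<^sub>\<alpha>] f| \<le> L M\<^sub>\<gamma> f\<close> wherever \<open>M\<^sub>\<alpha> f\<close> is
  finite. Suppose \<open>\<integral> \<Phi>(|f|) \<le> 1\<close> and let \<open>B\<close> be a ball with \<open>\<integral>\<^sub>B \<Phi>(|f|) \<le> s |B| \<le> 1\<close>. Convexity bounds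
  the average of \<open>|f|\<close> over \<open>B\<close> by \<open>2 \<Phi>\<^sup>-\<^sup>1(s)\<close>, and \<open>|B|\<^sup>\<gamma>\<^sup>/\<^sup>n \<le> s\<^sup>-\<^sup>\<gamma>\<^sup>/\<^sup>n\<close>, so the hypothesis on the
  inverses bounds the fractional mean over \<open>B\<close> by \<open>2 C \<Psi>\<^sup>-\<^sup>1(s)\<close>. Hence a fractional mean exceeding
  \<open>2 C t\<close> forces \<open>\<Psi>(t) |B| \<le> \<integral>\<^sub>B \<Phi>(|f|)\<close>. Summing over a Vitali subfamily yields
  \<open>\<Psi>(t) |{M\<^sub>\<gamma> f > 2 C t}| \<le> 5\<^sup>n\<close>, and convexity of \<open>\<Psi>\<close> absorbs \<open>5\<^sup>n\<close> into the constant.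

  Local integrability of the commutator does not follow from the weak bound (\<open>\<Psi>\<close> may grow only
  linearly). The choice \<open>s = 1 / |B|\<close> bounds the means over all balls of measure at least one, and
  near a bounded set the smaller balls only see an integrable truncation of \<open>f\<close>, to which the weak
  type \<open>(1, n / (n - \<gamma>))\<close> estimate for \<open>M\<^sub>\<gamma>\<close> applies. The same argument makes \<open>M\<^sub>\<alpha> f\<close> finite
  almost everywhere.
\<close>

section \<open>Covering by balls\<close>

lemma sets_lebesgue_ball [measurable]: "ball c r \<in> sets lebesgue"
  by simp

lemma emeasure_lebesgue_ball:
  "emeasure lebesgue (ball c r) = ennreal (measure lebesgue (ball c r))"
  by (rule emeasure_eq_measure2[OF lmeasurable_ball])

lemma measure_lebesgue_ball_pos: "0 < r \<Longrightarrow> 0 < measure lebesgue (ball c r)"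
  by (simp add: content_ball_pos)

lemma measure_lebesgue_ball:
  fixes c :: "'a::euclidean_space"
  assumes "0 \<le> r"
  shows "measure lebesgue (ball c r) = measure lebesgue (ball (0::'a) 1) * r ^ DIM('a)"
  by (simp only: measure_completion sets_lborel borel_open open_ball
      content_ball_conv_unit_ball[OF assms, of c] mult.commute)

lemma emeasure_lebesgue_ball_scale:
  fixes c :: "'a::euclidean_space"
  assumes "0 \<le> a" "0 \<le> r"
  shows "emeasure lebesgue (ball c (a * r)) = ennreal a ^ DIM('a) * emeasure lebesgue (ball c r)"
proof -
  have "emeasure lebesgue (ball c (a * r))
      = ennreal (a ^ DIM('a) * r ^ DIM('a)) * emeasure lebesgue (ball (0::'a) 1)"
    using assms emeasure_lebesgue_ball_conv_unit_ball[of "a * r" c] by (simp add: power_mult_distrib)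
  also have "\<dots> = ennreal a ^ DIM('a) * (ennreal (r ^ DIM('a)) * emeasure lebesgue (ball (0::'a) 1))"
    using assms by (simp only: ennreal_mult ennreal_power zero_le_power mult.assoc)
  also have "\<dots> = ennreal a ^ DIM('a) * emeasure lebesgue (ball c r)"
    using assms by (simp only: emeasure_lebesgue_ball_conv_unit_ball[of r c])
  finally show ?thesis .
qed

lemma radius_le_of_measure_ball_le:
  obtains \<rho> where
    "\<And>(c::'a::euclidean_space) r. measure lebesgue (ball c r) \<le> m \<Longrightarrow> r \<le> \<rho>"
proof
  define v where "v = measure lebesgue (ball (0::'a) 1)"
  have "0 < v"
    unfolding v_def by (rule measure_lebesgue_ball_pos) simp
  fix c :: 'a and r
  assume le: "measure lebesgue (ball c r) \<le> m"
  show "r \<le> max 1 (m / v)"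
  proof (cases "1 \<le> r")
    case True
    then have "v * r ^ DIM('a) \<le> m"
      using le by (subst (asm) measure_lebesgue_ball) (simp_all only: v_def)
    have "r \<le> r ^ DIM('a)"
      using True by (simp add: self_le_power)
    also have "\<dots> \<le> m / v"
      using \<open>0 < v\<close> \<open>v * r ^ DIM('a) \<le> m\<close> by (simp add: pos_le_divide_eq mult.commute)
    finally show ?thesis by simp
  qed simp
qed

lemma emeasure_UN_le_nn_integral:
  assumes I: "countable I" and A: "\<And>i. i \<in> I \<Longrightarrow> A i \<in> sets M"
  shows "emeasure M (\<Union>i\<in>I. A i) \<le> (\<integral>\<^sup>+i. emeasure M (A i) \<partial>count_space I)"
proof -
  have "(\<Union>i\<in>I. A i) \<in> sets M"
    using I A by auto
  then have "emeasure M (\<Union>i\<in>I. A i) = (\<integral>\<^sup>+x. indicator (\<Union>i\<in>I. A i) x \<partial>M)"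
    by simp
  also have "\<dots> \<le> (\<integral>\<^sup>+x. (\<integral>\<^sup>+i. indicator (A i) x \<partial>count_space I) \<partial>M)"
  proof (rule nn_integral_mono)
    fix x
    show "indicator (\<Union>i\<in>I. A i) x \<le> (\<integral>\<^sup>+i. indicator (A i) x \<partial>count_space I :: ennreal)"
    proof (cases "x \<in> (\<Union>i\<in>I. A i)")
      case True
      then obtain j where "j \<in> I" "x \<in> A j" by auto
      with True show ?thesis
        using nn_integral_ge_point[of j I "\<lambda>i. indicator (A i) x"] by simp
    qed simp
  qed
  also have "\<dots> = (\<integral>\<^sup>+i. (\<integral>\<^sup>+x. indicator (A i) x \<partial>M) \<partial>count_space I)"
    using I A by (intro nn_integral_count_space_nn_integral) auto
  also have "\<dots> = (\<integral>\<^sup>+i. emeasure M (A i) \<partial>count_space I)"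
    using A by (intro nn_integral_cong) auto
  finally show ?thesis .
qed

lemma emeasure_UN_bounded_balls_le:
  fixes W :: "('a::euclidean_space \<times> real) set"
  assumes sets_N: "sets borel \<subseteq> sets N" and radius: "\<And>c r. (c, r) \<in> W \<Longrightarrow> 0 < r \<and> r \<le> \<rho>"
    and ball_le: "\<And>c r. (c, r) \<in> W \<Longrightarrow> k * emeasure lebesgue (ball c r) \<le> emeasure N (ball c r)"
  shows "k * emeasure lebesgue (\<Union>(c, r)\<in>W. ball c r) \<le> 5 ^ DIM('a) * emeasure N (space N)"
proof -
  obtain C where C: "countable C" "C \<subseteq> W"
    and disjoint: "pairwise (\<lambda>i j. disjnt (ball (fst i) (snd i)) (ball (fst j) (snd j))) C"
    and covers: "(\<Union>(c, r)\<in>W. ball c r) \<subseteq> (\<Union>i\<in>C. ball (fst i) (5 * snd i))"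
    by (rule Vitali_covering_lemma_balls[where S = "\<Union>(c, r)\<in>W. ball c r" and K = W
            and a = fst and r = snd and B = \<rho>]) (use radius in auto)
  have "emeasure lebesgue (\<Union>(c, r)\<in>W. ball c r)
      \<le> emeasure lebesgue (\<Union>i\<in>C. ball (fst i) (5 * snd i))"
    using covers C(1) by (intro emeasure_mono sets.countable_UN') auto
  also have "\<dots> \<le> (\<integral>\<^sup>+i. emeasure lebesgue (ball (fst i) (5 * snd i)) \<partial>count_space C)"
    using C by (intro emeasure_UN_le_nn_integral) auto
  finally have "k * emeasure lebesgue (\<Union>(c, r)\<in>W. ball c r)
      \<le> (\<integral>\<^sup>+i. k * emeasure lebesgue (ball (fst i) (5 * snd i)) \<partial>count_space C)"
    by (simp add: nn_integral_cmult mult_left_mono)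
  also have "\<dots> \<le> (\<integral>\<^sup>+i. 5 ^ DIM('a) * emeasure N (ball (fst i) (snd i)) \<partial>count_space C)"
  proof (rule nn_integral_mono)
    fix i assume "i \<in> space (count_space C)"
    then have "(fst i, snd i) \<in> W" using C by auto
    moreover from this have "emeasure lebesgue (ball (fst i) (5 * snd i))
        = 5 ^ DIM('a) * emeasure lebesgue (ball (fst i) (snd i))"
      using radius emeasure_lebesgue_ball_scale[of 5 "snd i" "fst i"] by fastforce
    ultimately show "k * emeasure lebesgue (ball (fst i) (5 * snd i))
        \<le> 5 ^ DIM('a) * emeasure N (ball (fst i) (snd i))"
      by (simp add: ball_le mult.left_commute[of k] mult_left_mono del: emeasure_completion)
  qed
  also have "\<dots> = 5 ^ DIM('a) * (\<integral>\<^sup>+i. emeasure N (ball (fst i) (snd i)) \<partial>count_space C)"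
    by (simp add: nn_integral_cmult)
  also have "(\<integral>\<^sup>+i. emeasure N (ball (fst i) (snd i)) \<partial>count_space C)
      = emeasure N (\<Union>i\<in>C. ball (fst i) (snd i))"
    using C disjoint subsetD[OF sets_N borel_open] by (intro emeasure_UN_countable[symmetric])
      (auto simp: disjoint_family_on_def pairwise_def disjnt_def)
  also have "5 ^ DIM('a) * \<dots> \<le> 5 ^ DIM('a) * emeasure N (space N)"
    by (intro mult_left_mono emeasure_space) simp
  finally show ?thesis .
qed

lemma emeasure_UN_balls_le:
  fixes W :: "('a::euclidean_space \<times> real) set"
  assumes sets_N: "sets borel \<subseteq> sets N" and pos: "\<And>c r. (c, r) \<in> W \<Longrightarrow> 0 < r"
    and ball_le: "\<And>c r. (c, r) \<in> W \<Longrightarrow> k * emeasure lebesgue (ball c r) \<le> emeasure N (ball c r)"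
  shows "k * emeasure lebesgue (\<Union>(c, r)\<in>W. ball c r) \<le> 5 ^ DIM('a) * emeasure N (space N)"
proof (cases "k = 0 \<or> emeasure N (space N) = top")
  case False
  define \<epsilon> where "\<epsilon> = enn2real (min 1 k)"
  have \<epsilon>: "0 < \<epsilon>" "ennreal \<epsilon> \<le> k"
    using False by (auto simp: \<epsilon>_def enn2real_positive_iff min_less_iff_disj zero_less_iff_neq_zero)
  obtain J where J: "emeasure N (space N) = ennreal J" "0 \<le> J"
    using False by (cases "emeasure N (space N)") auto
  obtain \<rho> where \<rho>: "\<And>(c::'a) r. measure lebesgue (ball c r) \<le> J / \<epsilon> \<Longrightarrow> r \<le> \<rho>"
    using radius_le_of_measure_ball_le[where 'a='a and m="J / \<epsilon>"] by blast
  show ?thesis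
  proof (rule emeasure_UN_bounded_balls_le[OF sets_N _ ball_le])
    fix c r assume W: "(c, r) \<in> W"
    have "ennreal (\<epsilon> * measure lebesgue (ball c r)) \<le> k * emeasure lebesgue (ball c r)"
      unfolding emeasure_lebesgue_ball using \<epsilon> by (simp add: ennreal_mult mult_right_mono)
    also have "\<dots> \<le> emeasure N (space N)"
      using ball_le[OF W] by (rule order_trans) (rule emeasure_space)
    finally have "\<epsilon> * measure lebesgue (ball c r) \<le> J"
      using J by simp
    then show "0 < r \<and> r \<le> \<rho>"
      using pos[OF W] \<rho>[of c r] \<epsilon> by (simp add: field_simps)
  qed
qed auto

section \<open>Young functions\<close>

lemma young_function_zero: "young_function \<Phi> \<Longrightarrow> \<Phi> 0 = 0"
  by (simp add: young_function_def)

lemma young_function_scale: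
  assumes \<Phi>: "young_function \<Phi>" and "0 \<le> u" "u \<le> 1" "0 \<le> x"
  shows "\<Phi> (u * x) \<le> ennreal u * \<Phi> x"
proof -
  have "\<Phi> ((1 - u) * 0 + u * x) \<le> ennreal (1 - u) * \<Phi> 0 + ennreal u * \<Phi> x"
    using assms unfolding young_function_def by (metis atLeastAtMost_iff order_refl)
  then show ?thesis
    using young_function_zero[OF \<Phi>] by simp
qed

lemma young_function_mono:
  assumes \<Phi>: "young_function \<Phi>" and "0 \<le> x" "x \<le> y"
  shows "\<Phi> x \<le> \<Phi> y"
proof (cases "y = 0")
  case False
  then have "\<Phi> (x / y * y) \<le> ennreal (x / y) * \<Phi> y"
    using assms by (intro young_function_scale) auto
  also have "\<dots> \<le> 1 * \<Phi> y"
    using assms False by (intro mult_right_mono) (auto simp: ennreal_le_1)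
  finally show ?thesis
    using False by simp
qed (use assms in auto)

lemma young_function_exists_gt:
  assumes "young_function \<Phi>"
  obtains t where "0 < t" "ennreal a < \<Phi> t"
proof -
  have "(\<Phi> \<longlongrightarrow> \<infinity>) at_top"
    using assms by (simp add: young_function_def)
  then have "\<forall>\<^sub>F t in at_top. ennreal a < \<Phi> t"
    by (rule order_tendstoD) simp
  then have "\<forall>\<^sub>F t in at_top. ennreal a < \<Phi> t \<and> 0 < t"
    by (intro eventually_conj eventually_gt_at_top)
  then show ?thesis
    using that by (auto dest!: eventually_happens)
qed

lemma borel_measurable_young_function:
  assumes \<Phi>: "young_function \<Phi>" and f [measurable]: "f \<in> borel_measurable M"
  shows "(\<lambda>x. \<Phi> \<bar>f x\<bar>) \<in> borel_measurable M"
proof -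
  have "(\<lambda>r. \<Phi> (max 0 r)) \<in> borel_measurable borel"
  proof (rule borel_measurableI_greater)
    fix y
    have "is_interval {r. y < \<Phi> (max 0 r)}"
      unfolding is_interval_1
      by (auto intro: less_le_trans[OF _ young_function_mono[OF \<Phi>]])
    then show "{r \<in> space borel. y < \<Phi> (max 0 r)} \<in> sets borel"
      by (simp add: real_interval_borel_measurable)
  qed
  then have "(\<lambda>x. \<Phi> (max 0 \<bar>f x\<bar>)) \<in> borel_measurable M"
    by (rule measurable_compose[rotated]) measurable
  then show ?thesis
    by simp
qed

lemma le_young_inverse:
  assumes \<Phi>: "young_function \<Phi>" and "0 \<le> z" "\<Phi> z \<le> ennreal s"
  shows "z \<le> young_inverse \<Phi> s"
  unfolding young_inverse_def
proof (rule cInf_greatest)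
  show "{r. 0 \<le> r \<and> ennreal s < \<Phi> r} \<noteq> {}"
    using young_function_exists_gt[OF \<Phi>, of s] by force
  fix r assume "r \<in> {r. 0 \<le> r \<and> ennreal s < \<Phi> r}"
  then show "z \<le> r"
    using young_function_mono[OF \<Phi>, of r z] assms by (force simp: not_le)
qed

lemma young_inverse_nonneg: "young_function \<Phi> \<Longrightarrow> 0 \<le> young_inverse \<Phi> s"
  by (rule le_young_inverse) (auto simp: young_function_zero)

lemma young_inverse_mono:
  assumes \<Phi>: "young_function \<Phi>" and "s \<le> t"
  shows "young_inverse \<Phi> s \<le> young_inverse \<Phi> t"
  unfolding young_inverse_def
proof (rule cInf_superset_mono)
  show "{r. 0 \<le> r \<and> ennreal t < \<Phi> r} \<noteq> {}"
    using young_function_exists_gt[OF \<Phi>, of t] by force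
  show "{r. 0 \<le> r \<and> ennreal t < \<Phi> r} \<subseteq> {r. 0 \<le> r \<and> ennreal s < \<Phi> r}"
    using \<open>s \<le> t\<close> by (auto intro: le_less_trans ennreal_leI)
qed (rule bdd_belowI[of _ 0], simp)

lemma less_young_inverseD:
  assumes "0 \<le> t" "t < young_inverse \<Psi> s"
  shows "\<Psi> t \<le> ennreal s"
proof (rule ccontr)
  assume "\<not> \<Psi> t \<le> ennreal s"
  then have "young_inverse \<Psi> s \<le> t"
    unfolding young_inverse_def using assms
    by (intro cInf_lower) (auto simp: not_le intro: bdd_belowI)
  then show False using assms by simp
qed

lemma young_function_mult_diff_le:
  assumes \<Phi>: "young_function \<Phi>" and "0 \<le> z"
  shows "\<Phi> z * ennreal (y - z) \<le> ennreal z * \<Phi> y"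
proof (cases "z < y")
  case True
  have "\<Phi> z * ennreal (y - z) \<le> \<Phi> z * ennreal y"
    using \<open>0 \<le> z\<close> by (intro mult_left_mono ennreal_leI) auto
  also have "\<dots> \<le> (ennreal (z / y) * \<Phi> y) * ennreal y"
    using young_function_scale[OF \<Phi>, of "z / y" y] True \<open>0 \<le> z\<close> by (intro mult_right_mono) auto
  also have "\<dots> = ennreal (z / y * y) * \<Phi> y"
    using True \<open>0 \<le> z\<close> by (subst ennreal_mult) (auto simp: mult_ac)
  finally show ?thesis
    using True \<open>0 \<le> z\<close> by simp
qed (simp add: ennreal_neg)

text \<open>
  Jensen's inequality up to a factor \<open>2\<close>: the secant bound of the previous lemma plays the role of a
  supporting line.
\<close>

lemma young_function_le_mean:
  assumes \<Phi>: "young_function \<Phi>" and f [measurable]: "f \<in> borel_measurable M"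
    and A [measurable]: "A \<in> sets M" and A_fin: "emeasure M A < \<infinity>" and z: "0 < z"
    and mean: "ennreal (2 * z) * emeasure M A \<le> (\<integral>\<^sup>+x\<in>A. ennreal \<bar>f x\<bar> \<partial>M)"
  shows "\<Phi> z * emeasure M A \<le> (\<integral>\<^sup>+x\<in>A. \<Phi> \<bar>f x\<bar> \<partial>M)"
proof -
  have [measurable]: "(\<lambda>x. \<Phi> \<bar>f x\<bar>) \<in> borel_measurable M"
    by (rule borel_measurable_young_function[OF \<Phi> f])
  have "ennreal z * emeasure M A + ennreal z * emeasure M A \<le> (\<integral>\<^sup>+x\<in>A. ennreal \<bar>f x\<bar> \<partial>M)"
    using mean z by (simp flip: distrib_right ennreal_plus)
  also have "\<dots> \<le> (\<integral>\<^sup>+x. ennreal z * indicator A x + ennreal (\<bar>f x\<bar> - z) * indicator A x \<partial>M)"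
    using z by (intro nn_integral_mono)
      (auto simp: indicator_def ennreal_plus_if not_less intro: ennreal_leI)
  also have "\<dots> = ennreal z * emeasure M A + (\<integral>\<^sup>+x\<in>A. ennreal (\<bar>f x\<bar> - z) \<partial>M)"
    by (subst nn_integral_add) (auto simp: nn_integral_cmult)
  finally have "ennreal z * emeasure M A \<le> (\<integral>\<^sup>+x\<in>A. ennreal (\<bar>f x\<bar> - z) \<partial>M)"
    using A_fin by (subst (asm) ennreal_add_left_cancel_le) (auto simp: ennreal_mult_eq_top_iff)
  then have "ennreal z * (\<Phi> z * emeasure M A) \<le> \<Phi> z * (\<integral>\<^sup>+x\<in>A. ennreal (\<bar>f x\<bar> - z) \<partial>M)"
    by (subst mult.left_commute) (rule mult_left_mono, auto)
  also have "\<dots> = (\<integral>\<^sup>+x. \<Phi> z * ennreal (\<bar>f x\<bar> - z) * indicator A x \<partial>M)"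
    by (simp add: mult.assoc nn_integral_cmult)
  also have "\<dots> \<le> (\<integral>\<^sup>+x. ennreal z * (\<Phi> \<bar>f x\<bar> * indicator A x) \<partial>M)"
    using z by (intro nn_integral_mono) (auto simp: indicator_def young_function_mult_diff_le[OF \<Phi>])
  also have "\<dots> = ennreal z * (\<integral>\<^sup>+x\<in>A. \<Phi> \<bar>f x\<bar> \<partial>M)"
    by (rule nn_integral_cmult) measurable
  finally show ?thesis
    using z by (subst (asm) ennreal_mult_le_mult_iff) auto
qed

lemma nn_integral_le_young_inverse:
  assumes \<Phi>: "young_function \<Phi>" and f: "f \<in> borel_measurable M"
    and A: "A \<in> sets M" "emeasure M A < \<infinity>"
    and modular: "(\<integral>\<^sup>+x\<in>A. \<Phi> \<bar>f x\<bar> \<partial>M) \<le> ennreal s * emeasure M A"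
  shows "(\<integral>\<^sup>+x\<in>A. ennreal \<bar>f x\<bar> \<partial>M) \<le> ennreal (2 * young_inverse \<Phi> s) * emeasure M A"
proof (cases "emeasure M A = 0")
  case True
  then have "A \<in> null_sets M"
    using A by auto
  then show ?thesis
    by (simp add: nn_integral_null_set)
next
  case False
  obtain m where m: "emeasure M A = ennreal m" "0 < m"
    using A False by (cases "emeasure M A") (auto simp: less_le)
  have le_inverse: "z \<le> young_inverse \<Phi> s"
    if "0 < z" "ennreal (2 * z) * emeasure M A \<le> (\<integral>\<^sup>+x\<in>A. ennreal \<bar>f x\<bar> \<partial>M)" for z
  proof (rule le_young_inverse[OF \<Phi>])
    have "\<Phi> z * emeasure M A \<le> ennreal s * emeasure M A"
      using young_function_le_mean[OF \<Phi> f A that] modular by (rule order_trans)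
    then show "\<Phi> z \<le> ennreal s"
      using m by (simp add: mult.commute[of _ "ennreal m"] ennreal_mult_le_mult_iff)
  qed (use \<open>0 < z\<close> in simp)
  show ?thesis
  proof (cases "\<integral>\<^sup>+x\<in>A. ennreal \<bar>f x\<bar> \<partial>M")
    case (real i)
    have "i / (2 * m) \<le> young_inverse \<Phi> s" if "0 < i"
      using m real that by (intro le_inverse) (auto simp flip: ennreal_mult)
    then have "i \<le> 2 * young_inverse \<Phi> s * m"
      using m real young_inverse_nonneg[OF \<Phi>, of s] by (cases "i = 0") (auto simp: field_simps)
    then show ?thesis
      using m real young_inverse_nonneg[OF \<Phi>, of s] by (simp add: ennreal_leI flip: ennreal_mult)
  next
    case top
    then show ?thesis
      using le_inverse[of "young_inverse \<Phi> s + 1"] young_inverse_nonneg[OF \<Phi>, of s] by simp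
  qed
qed

lemma nn_integral_le_young_inverse_scaled:
  assumes \<Phi>: "young_function \<Phi>" and f [measurable]: "f \<in> borel_measurable M"
    and A [measurable]: "A \<in> sets M" and A_fin: "emeasure M A < \<infinity>" and l: "0 < l"
    and modular: "(\<integral>\<^sup>+x\<in>A. \<Phi> (\<bar>f x\<bar> / l) \<partial>M) \<le> ennreal s * emeasure M A"
  shows "(\<integral>\<^sup>+x\<in>A. ennreal \<bar>f x\<bar> \<partial>M) \<le> ennreal (2 * l * young_inverse \<Phi> s) * emeasure M A"
proof -
  have "(\<integral>\<^sup>+x\<in>A. ennreal \<bar>f x / l\<bar> \<partial>M) \<le> ennreal (2 * young_inverse \<Phi> s) * emeasure M A"
    using modular l by (intro nn_integral_le_young_inverse[OF \<Phi> _ A A_fin]) simp_all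
  then have "ennreal l * (\<integral>\<^sup>+x\<in>A. ennreal \<bar>f x / l\<bar> \<partial>M)
      \<le> ennreal l * (ennreal (2 * young_inverse \<Phi> s) * emeasure M A)"
    by (rule mult_left_mono) simp
  also have "\<dots> = ennreal (2 * l * young_inverse \<Phi> s) * emeasure M A"
    using l by (simp add: ennreal_mult' mult_ac)
  also have "ennreal l * (\<integral>\<^sup>+x\<in>A. ennreal \<bar>f x / l\<bar> \<partial>M)
      = (\<integral>\<^sup>+x. ennreal l * (ennreal \<bar>f x / l\<bar> * indicator A x) \<partial>M)"
    by (rule nn_integral_cmult[symmetric]) measurable
  also have "\<dots> = (\<integral>\<^sup>+x\<in>A. ennreal \<bar>f x\<bar> \<partial>M)"
    using l by (intro nn_integral_cong) (simp flip: mult.assoc ennreal_mult)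
  finally show ?thesis .
qed

section \<open>Fractional maximal functions\<close>

lemma L1_loc_realD:
  fixes f :: "'a::euclidean_space \<Rightarrow> real"
  assumes "(\<lambda>x. ereal (f x)) \<in> L1_loc"
  shows "f \<in> borel_measurable lebesgue"
    and "(\<integral>\<^sup>+y\<in>ball c r. ennreal \<bar>f y\<bar> \<partial>lebesgue) < \<infinity>"
proof -
  have "(\<lambda>x. real_of_ereal (ereal (f x))) \<in> borel_measurable lebesgue"
    using assms unfolding L1_loc_def by (intro borel_measurable_real_of_ereal) blast
  then show "f \<in> borel_measurable lebesgue"
    by simp
  have "(\<integral>\<^sup>+y\<in>ball c r. ennreal \<bar>f y\<bar> \<partial>lebesgue) \<le> (\<integral>\<^sup>+y\<in>cball c r. e2ennreal \<bar>ereal (f y)\<bar> \<partial>lebesgue)"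
    by (intro nn_integral_mono) (auto simp: indicator_def)
  also have "\<dots> < \<infinity>"
    using assms compact_cball[of c r] by (simp add: L1_loc_def)
  finally show "(\<integral>\<^sup>+y\<in>ball c r. ennreal \<bar>f y\<bar> \<partial>lebesgue) < \<infinity>" .
qed

definition frac_mean :: "real \<Rightarrow> ('a::euclidean_space \<Rightarrow> real) \<Rightarrow> 'a \<Rightarrow> real \<Rightarrow> ennreal" where
  "frac_mean \<alpha> f c r = ennreal (measure lebesgue (ball c r) powr (- 1 + \<alpha> / DIM('a))) *
     (\<integral>\<^sup>+y\<in>ball c r. ennreal \<bar>f y\<bar> \<partial>lebesgue)"

lemma frac_maximal_eq:
  "frac_maximal \<alpha> f x = (SUP (c, r)\<in>{(c, r). 0 < r \<and> x \<in> ball c r}. frac_mean \<alpha> f c r)"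
  by (simp add: frac_maximal_def frac_mean_def)

lemma frac_mean_le_maximal:
  "0 < r \<Longrightarrow> x \<in> ball c r \<Longrightarrow> frac_mean \<alpha> f c r \<le> frac_maximal \<alpha> f x"
  unfolding frac_maximal_eq by (rule SUP_upper2[of "(c, r)"]) auto

lemma frac_maximal_leI:
  "(\<And>c r. 0 < r \<Longrightarrow> x \<in> ball c r \<Longrightarrow> frac_mean \<alpha> f c r \<le> u) \<Longrightarrow> frac_maximal \<alpha> f x \<le> u"
  unfolding frac_maximal_eq by (auto intro: SUP_least)

lemma frac_maximal_superlevel:
  "{x. s < frac_maximal \<alpha> f x} = (\<Union>(c, r)\<in>{(c, r). 0 < r \<and> s < frac_mean \<alpha> f c r}. ball c r)"
  unfolding frac_maximal_eq less_SUP_iff by fastforce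

lemma borel_measurable_frac_maximal [measurable]:
  "frac_maximal \<alpha> f \<in> borel_measurable lebesgue"
proof -
  have "frac_maximal \<alpha> f \<in> borel_measurable borel"
    by (rule borel_measurableI_greater)
      (auto simp: frac_maximal_superlevel intro!: borel_open open_UN)
  then show ?thesis
    by (rule borel_measurable_subalgebra[rotated 2]) auto
qed

lemma frac_mean_cmult:
  fixes f :: "'a::euclidean_space \<Rightarrow> real"
  assumes [measurable]: "f \<in> borel_measurable lebesgue" and "0 \<le> a"
  shows "frac_mean \<alpha> (\<lambda>y. a * f y) c r = ennreal a * frac_mean \<alpha> f c r"
proof -
  have "(\<integral>\<^sup>+y\<in>ball c r. ennreal \<bar>a * f y\<bar> \<partial>lebesgue)
      = (\<integral>\<^sup>+y. ennreal a * (ennreal \<bar>f y\<bar> * indicator (ball c r) y) \<partial>lebesgue)"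
    using \<open>0 \<le> a\<close> by (simp add: abs_mult ennreal_mult mult.assoc)
  then show ?thesis
    by (simp add: frac_mean_def nn_integral_cmult mult.left_commute)
qed

lemma frac_maximal_cmult:
  fixes f :: "'a::euclidean_space \<Rightarrow> real"
  assumes "f \<in> borel_measurable lebesgue" and "0 \<le> a"
  shows "frac_maximal \<alpha> (\<lambda>y. a * f y) x = ennreal a * frac_maximal \<alpha> f x"
  unfolding frac_maximal_eq
  by (simp add: frac_mean_cmult[OF assms] SUP_mult_left_ennreal case_prod_unfold)

lemma frac_mean_mono_order:
  fixes f :: "'a::euclidean_space \<Rightarrow> real"
  assumes "1 \<le> measure lebesgue (ball c r)" "\<alpha> \<le> \<gamma>"
  shows "frac_mean \<alpha> f c r \<le> frac_mean \<gamma> f c r"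
  unfolding frac_mean_def using assms
  by (intro mult_right_mono ennreal_leI powr_mono) (simp_all add: divide_right_mono)

lemma frac_mean_mult_le:
  fixes p q f :: "'a::euclidean_space \<Rightarrow> real"
  assumes [measurable]: "q \<in> borel_measurable lebesgue" "f \<in> borel_measurable lebesgue"
    and "0 \<le> L"
    and osc: "\<And>y. y \<in> ball c r \<Longrightarrow>
      \<bar>p y - q y\<bar> \<le> L * measure lebesgue (ball c r) powr (\<beta> / DIM('a))"
  shows "frac_mean \<alpha> (\<lambda>y. p y * f y) c r
    \<le> frac_mean \<alpha> (\<lambda>y. q y * f y) c r + ennreal L * frac_mean (\<alpha> + \<beta>) f c r"
proof -
  define V where "V = measure lebesgue (ball c r)"
  define d where "d = L * V powr (\<beta> / DIM('a))"
  have "0 \<le> d"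
    using \<open>0 \<le> L\<close> by (simp add: d_def)
  have pointwise: "ennreal \<bar>p y * f y\<bar> \<le> ennreal \<bar>q y * f y\<bar> + ennreal d * ennreal \<bar>f y\<bar>"
    if "y \<in> ball c r" for y
  proof -
    have "\<bar>p y * f y\<bar> \<le> \<bar>q y * f y\<bar> + \<bar>p y - q y\<bar> * \<bar>f y\<bar>"
      unfolding abs_mult distrib_right[symmetric] by (intro mult_right_mono) auto
    also have "\<dots> \<le> \<bar>q y * f y\<bar> + d * \<bar>f y\<bar>"
      unfolding d_def V_def by (intro add_left_mono mult_right_mono osc that) simp
    finally have "ennreal \<bar>p y * f y\<bar> \<le> ennreal (\<bar>q y * f y\<bar> + d * \<bar>f y\<bar>)"
      by (rule ennreal_leI)
    then show ?thesis
      using \<open>0 \<le> d\<close> by (simp add: ennreal_plus ennreal_mult)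
  qed
  have "(\<integral>\<^sup>+y\<in>ball c r. ennreal \<bar>p y * f y\<bar> \<partial>lebesgue)
      \<le> (\<integral>\<^sup>+y. ennreal \<bar>q y * f y\<bar> * indicator (ball c r) y
          + ennreal d * (ennreal \<bar>f y\<bar> * indicator (ball c r) y) \<partial>lebesgue)"
    using pointwise by (intro nn_integral_mono) (auto simp: indicator_def)
  also have "\<dots> = (\<integral>\<^sup>+y\<in>ball c r. ennreal \<bar>q y * f y\<bar> \<partial>lebesgue)
      + ennreal d * (\<integral>\<^sup>+y\<in>ball c r. ennreal \<bar>f y\<bar> \<partial>lebesgue)"
    by (subst nn_integral_add) (auto simp: nn_integral_cmult)
  finally have "frac_mean \<alpha> (\<lambda>y. p y * f y) c r \<le> frac_mean \<alpha> (\<lambda>y. q y * f y) c r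
      + ennreal (V powr (- 1 + \<alpha> / DIM('a)) * d) * (\<integral>\<^sup>+y\<in>ball c r. ennreal \<bar>f y\<bar> \<partial>lebesgue)"
    unfolding frac_mean_def V_def[symmetric] using \<open>0 \<le> d\<close>
    by (simp add: ennreal_mult mult.assoc mult_left_mono flip: distrib_left)
  also have "V powr (- 1 + \<alpha> / DIM('a)) * d = L * V powr (- 1 + (\<alpha> + \<beta>) / DIM('a))"
    by (simp add: d_def add_divide_distrib algebra_simps flip: powr_add)
  finally show ?thesis
    using \<open>0 \<le> L\<close> by (simp add: frac_mean_def V_def ennreal_mult mult.assoc)
qed

lemma frac_maximal_mult_le:
  fixes p q f :: "'a::euclidean_space \<Rightarrow> real"
  assumes "q \<in> borel_measurable lebesgue" "f \<in> borel_measurable lebesgue" "0 \<le> L"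
    and osc: "\<And>c r y. \<lbrakk>0 < r; x \<in> ball c r; y \<in> ball c r\<rbrakk> \<Longrightarrow>
      \<bar>p y - q y\<bar> \<le> L * measure lebesgue (ball c r) powr (\<beta> / DIM('a))"
  shows "frac_maximal \<alpha> (\<lambda>y. p y * f y) x
    \<le> frac_maximal \<alpha> (\<lambda>y. q y * f y) x + ennreal L * frac_maximal (\<alpha> + \<beta>) f x"
proof (rule frac_maximal_leI)
  fix c r assume ball: "0 < r" "x \<in> ball c r"
  have "frac_mean \<alpha> (\<lambda>y. p y * f y) c r
      \<le> frac_mean \<alpha> (\<lambda>y. q y * f y) c r + ennreal L * frac_mean (\<alpha> + \<beta>) f c r"
    by (intro frac_mean_mult_le assms(1-3) osc ball)
  also have "\<dots> \<le> frac_maximal \<alpha> (\<lambda>y. q y * f y) x + ennreal L * frac_maximal (\<alpha> + \<beta>) f x"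
    by (intro add_mono mult_left_mono frac_mean_le_maximal ball) simp
  finally show "frac_mean \<alpha> (\<lambda>y. p y * f y) c r
      \<le> frac_maximal \<alpha> (\<lambda>y. q y * f y) x + ennreal L * frac_maximal (\<alpha> + \<beta>) f x" .
qed

section \<open>The commutator with a Lipschitz function\<close>

lemma lipschitz_space_oscillation_ball:
  fixes b :: "'a::euclidean_space \<Rightarrow> real"
  assumes "b \<in> lipschitz_space \<beta>" and \<beta>: "0 < \<beta>"
  obtains L where "0 < L"
    "\<And>c r x y. \<lbrakk>0 < r; x \<in> ball c r; y \<in> ball c r\<rbrakk> \<Longrightarrow>
      \<bar>b x - b y\<bar> \<le> L * measure lebesgue (ball c r) powr (\<beta> / DIM('a))"
proof -
  obtain C where C: "\<And>x y. \<bar>b x - b y\<bar> \<le> C * norm (x - y) powr \<beta>"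
    using assms by (auto simp: lipschitz_space_def)
  define v where "v = measure lebesgue (ball (0::'a) 1)"
  have "0 < v"
    unfolding v_def by (rule measure_lebesgue_ball_pos) simp
  define L where "L = (\<bar>C\<bar> + 1) * 2 powr \<beta> / v powr (\<beta> / DIM('a))"
  show ?thesis
  proof
    show "0 < L"
      using \<open>0 < v\<close> by (simp add: L_def)
    fix c :: 'a and r :: real and x y
    assume "0 < r" and xy: "x \<in> ball c r" "y \<in> ball c r"
    have "norm (x - y) \<le> 2 * r"
      using xy dist_triangle2[of x y c] by (simp add: dist_norm dist_commute norm_minus_commute)
    have "\<bar>b x - b y\<bar> \<le> C * norm (x - y) powr \<beta>"
      by (rule C)
    also have "\<dots> \<le> (\<bar>C\<bar> + 1) * (2 * r) powr \<beta>"
      using \<open>norm (x - y) \<le> 2 * r\<close> \<beta> by (intro mult_mono powr_mono2) auto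
    also have "\<dots> = L * (v powr (\<beta> / DIM('a)) * r powr \<beta>)"
      using \<open>0 < v\<close> \<open>0 < r\<close> by (simp add: L_def powr_mult)
    also have "v powr (\<beta> / DIM('a)) * r powr \<beta> = (v * r ^ DIM('a)) powr (\<beta> / DIM('a))"
      using \<open>0 < v\<close> \<open>0 < r\<close> by (simp add: powr_mult powr_powr flip: powr_realpow)
    also have "v * r ^ DIM('a) = measure lebesgue (ball c r)"
      unfolding v_def using \<open>0 < r\<close> by (intro measure_lebesgue_ball[symmetric]) simp
    finally show "\<bar>b x - b y\<bar> \<le> L * measure lebesgue (ball c r) powr (\<beta> / DIM('a))" .
  qed
qed

lemma abs_max_commutator_le:
  fixes b f :: "'a::euclidean_space \<Rightarrow> real"
  assumes b: "b \<in> borel_measurable lebesgue" and f: "f \<in> borel_measurable lebesgue"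
    and b_nonneg: "\<And>x. 0 \<le> b x" and L: "0 < L"
    and osc: "\<And>c r x y. \<lbrakk>0 < r; x \<in> ball c r; y \<in> ball c r\<rbrakk> \<Longrightarrow>
      \<bar>b x - b y\<bar> \<le> L * measure lebesgue (ball c r) powr (\<beta> / DIM('a))"
    and fin: "frac_maximal \<alpha> f x < \<infinity>"
  shows "e2ennreal \<bar>max_commutator \<alpha> b f x\<bar> \<le> ennreal L * frac_maximal (\<alpha> + \<beta>) f x"
proof (cases "ennreal L * frac_maximal (\<alpha> + \<beta>) f x")
  case (real u)
  obtain m where m: "frac_maximal \<alpha> f x = ennreal m" "0 \<le> m"
    using fin by (cases "frac_maximal \<alpha> f x") auto
  have const: "frac_maximal \<alpha> (\<lambda>y. b x * f y) x = ennreal (b x * m)"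
    using frac_maximal_cmult[OF f b_nonneg] m b_nonneg by (simp add: ennreal_mult)
  have upper: "frac_maximal \<alpha> (\<lambda>y. b y * f y) x \<le> ennreal (b x * m) + ennreal u"
    unfolding const[symmetric] real(2)[symmetric]
    by (intro frac_maximal_mult_le f osc) (use L in auto)
  then obtain q where q: "frac_maximal \<alpha> (\<lambda>y. b y * f y) x = ennreal q" "0 \<le> q"
    by (cases "frac_maximal \<alpha> (\<lambda>y. b y * f y) x") (auto simp: top_unique)
  have "ennreal (b x * m) \<le> ennreal q + ennreal u"
    unfolding const[symmetric] real(2)[symmetric] q(1)[symmetric]
    by (intro frac_maximal_mult_le b f osc) (use L in auto)
  then have "\<bar>b x * m - q\<bar> \<le> u"
    using upper q m real(1) b_nonneg[of x] by (simp add: abs_le_iff algebra_simps flip: ennreal_plus)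
  then show ?thesis
    unfolding real(2) max_commutator_def m(1) q(1) using m q by (simp add: ennreal_leI)
qed simp

section \<open>Functions of weak type\<close>

lemma nn_integral_set_le_suminf_superlevel:
  fixes h :: "'a \<Rightarrow> ennreal"
  assumes [measurable]: "h \<in> borel_measurable M" "S \<in> sets M" and fin: "AE x in M. h x < \<infinity>"
  shows "(\<integral>\<^sup>+x\<in>S. h x \<partial>M) \<le> (\<Sum>k. emeasure M {x \<in> S. ennreal (real k) < h x})"
proof -
  define n where "n x = (if x \<in> S then nat \<lceil>enn2real (h x)\<rceil> else 0)" for x
  have [measurable]: "n \<in> measurable M (count_space UNIV)"
    unfolding n_def by measurable
  have "AE x in M. h x * indicator S x \<le> of_nat (n x)"
    using fin
  proof eventually_elim
    case (elim x)
    have "h x \<le> of_nat (nat \<lceil>enn2real (h x)\<rceil>)"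
      using elim by (cases "h x") (auto simp: ennreal_of_nat_eq_real_of_nat intro!: ennreal_leI)
    then show ?case
      by (simp add: n_def indicator_def)
  qed
  then have "(\<integral>\<^sup>+x\<in>S. h x \<partial>M) \<le> (\<integral>\<^sup>+x. of_nat (n x) \<partial>M)"
    by (rule nn_integral_mono_AE)
  also have "\<dots> = (\<Sum>k. emeasure M {x \<in> space M. k < n x})"
    by (rule nn_integral_nat_function) measurable
  also have "\<dots> \<le> (\<Sum>k. emeasure M {x \<in> S. ennreal (real k) < h x})"
  proof (intro suminf_le emeasure_mono subsetI)
    show "x \<in> {x \<in> S. ennreal (real k) < h x}" if "x \<in> {x \<in> space M. k < n x}" for x k
    proof -
      have "x \<in> S" "real k < enn2real (h x)"
        using that by (auto simp: n_def split: if_splits) linarith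
      then show ?thesis
        by (cases "h x") (auto simp: ennreal_less_iff)
    qed
  qed auto
  finally show ?thesis .
qed

context
  fixes M :: "'a measure" and h :: "'a \<Rightarrow> ennreal" and A p :: real
  assumes h [measurable]: "h \<in> borel_measurable M"
    and weak_type: "\<And>s. 0 < s \<Longrightarrow>
      emeasure M {x \<in> space M. ennreal s < h x} \<le> ennreal (A * s powr (- p))"
begin

lemma weak_type_finite_AE:
  assumes "0 < p"
  shows "AE x in M. h x < \<infinity>"
proof -
  have "(\<lambda>k. ennreal (A * real (Suc k) powr (- p))) \<longlonglongrightarrow> ennreal (A * 0)"
    using \<open>0 < p\<close>
    by (intro tendsto_ennrealI tendsto_mult tendsto_const tendsto_neg_powr
        filterlim_compose[OF filterlim_real_sequentially filterlim_Suc]) auto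
  moreover have "emeasure M {x \<in> space M. h x = \<infinity>} \<le> ennreal (A * real (Suc k) powr (- p))" for k
  proof -
    have "emeasure M {x \<in> space M. h x = \<infinity>} \<le> emeasure M {x \<in> space M. ennreal (real (Suc k)) < h x}"
      by (intro emeasure_mono) auto
    also have "\<dots> \<le> ennreal (A * real (Suc k) powr (- p))"
      by (rule weak_type) simp
    finally show ?thesis .
  qed
  ultimately have "emeasure M {x \<in> space M. h x = \<infinity>} \<le> ennreal (A * 0)"
    by (intro LIMSEQ_le_const) auto
  then show ?thesis
    by (intro AE_I[of _ _ "{x \<in> space M. h x = \<infinity>}"]) (auto simp: not_less top_unique)
qed

lemma weak_type_nn_integral_finite:
  assumes p: "1 < p" and "0 \<le> A" and S [measurable]: "S \<in> sets M" and S_fin: "emeasure M S < \<infinity>"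
  shows "(\<integral>\<^sup>+x\<in>S. h x \<partial>M) < \<infinity>"
proof -
  define a where "a k = (if k = 0 then measure M S else 0) + A * real k powr (- p)" for k
  have level: "emeasure M {x \<in> S. ennreal (real k) < h x} \<le> ennreal (a k)" for k
  proof (cases "k = 0")
    case True
    have "emeasure M {x \<in> S. ennreal (real k) < h x} \<le> emeasure M S"
      by (intro emeasure_mono) auto
    then show ?thesis
      using S_fin True by (simp add: a_def emeasure_eq_ennreal_measure)
  next
    case False
    have "emeasure M {x \<in> S. ennreal (real k) < h x}
        \<le> emeasure M {x \<in> space M. ennreal (real k) < h x}"
      using sets.sets_into_space[OF S] by (intro emeasure_mono) auto
    also have "\<dots> \<le> ennreal (A * real k powr (- p))"
      using False by (intro weak_type) simp
    finally show ?thesis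
      using False by (simp add: a_def)
  qed
  have "summable a"
    unfolding a_def using p
    by (intro summable_add summable_mult summable_single[of 0 "\<lambda>_. measure M S"])
      (simp add: summable_real_powr_iff)
  have "(\<integral>\<^sup>+x\<in>S. h x \<partial>M) \<le> (\<Sum>k. emeasure M {x \<in> S. ennreal (real k) < h x})"
    using p by (intro nn_integral_set_le_suminf_superlevel weak_type_finite_AE h S) simp
  also have "\<dots> \<le> (\<Sum>k. ennreal (a k))"
    by (intro suminf_le level) auto
  also have "\<dots> < \<infinity>"
    using ennreal_suminf_neq_top[OF \<open>summable a\<close>] \<open>0 \<le> A\<close> by (simp add: a_def less_top)
  finally show ?thesis .
qed

end

section \<open>Finiteness and local integrability of the fractional maximal function\<close>

lemma frac_mean_weak_type:
  fixes f :: "'a::euclidean_space \<Rightarrow> real" and \<alpha> :: real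
  assumes \<alpha>: "0 \<le> \<alpha>" "\<alpha> < DIM('a)" and p: "p = DIM('a) / (DIM('a) - \<alpha>)"
    and G: "(\<integral>\<^sup>+y. ennreal \<bar>f y\<bar> \<partial>lebesgue) \<le> ennreal G" "0 \<le> G"
    and s: "0 < s" and r: "0 < r" and gt: "ennreal s < frac_mean \<alpha> f c r"
  shows "ennreal (s powr p) * emeasure lebesgue (ball c r)
    \<le> ennreal (G powr (p - 1)) * (\<integral>\<^sup>+y\<in>ball c r. ennreal \<bar>f y\<bar> \<partial>lebesgue)"
proof -
  define V where "V = measure lebesgue (ball c r)"
  have V: "0 < V" "emeasure lebesgue (ball c r) = ennreal V"
    unfolding V_def by (rule measure_lebesgue_ball_pos[OF r] emeasure_lebesgue_ball)+
  have p': "1 \<le> p" "(1 - \<alpha> / DIM('a)) * p = 1"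
    using \<alpha> by (auto simp: p field_simps)
  have "(\<integral>\<^sup>+y\<in>ball c r. ennreal \<bar>f y\<bar> \<partial>lebesgue) \<le> (\<integral>\<^sup>+y. ennreal \<bar>f y\<bar> \<partial>lebesgue)"
    by (intro nn_integral_mono) (auto simp: indicator_def)
  then obtain i where i: "(\<integral>\<^sup>+y\<in>ball c r. ennreal \<bar>f y\<bar> \<partial>lebesgue) = ennreal i" "0 \<le> i" "i \<le> G"
    using G by (cases "\<integral>\<^sup>+y\<in>ball c r. ennreal \<bar>f y\<bar> \<partial>lebesgue")
      (auto simp: top_unique dest: order_trans)
  have "s < V powr (- (1 - \<alpha> / DIM('a))) * i"
    using gt i s unfolding frac_mean_def i(1) V_def[symmetric]
    by (simp add: ennreal_less_iff flip: ennreal_mult)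
  then have less: "s * V powr (1 - \<alpha> / DIM('a)) < i"
    using V by (simp add: powr_minus field_simps)
  have "0 < s * V powr (1 - \<alpha> / DIM('a))"
    using s V by simp
  with less have "0 < i" by linarith
  have "s powr p * V = (s * V powr (1 - \<alpha> / DIM('a))) powr p"
    using s V p' by (simp add: powr_mult powr_powr)
  also have "\<dots> \<le> i powr p"
    using less s p' by (intro powr_mono2) auto
  also have "\<dots> = i powr (p - 1) * i"
    using \<open>0 < i\<close> by (simp add: powr_diff)
  also have "\<dots> \<le> G powr (p - 1) * i"
    using i p' by (intro mult_right_mono powr_mono2) auto
  finally show ?thesis
    unfolding V(2) i(1) using V i by (simp add: ennreal_leI flip: ennreal_mult)
qed

lemma frac_maximal_weak_type:
  fixes f :: "'a::euclidean_space \<Rightarrow> real" and \<alpha> :: real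
  assumes f [measurable]: "f \<in> borel_measurable lebesgue"
    and \<alpha>: "0 \<le> \<alpha>" "\<alpha> < DIM('a)" and p: "p = DIM('a) / (DIM('a) - \<alpha>)"
    and G: "(\<integral>\<^sup>+y. ennreal \<bar>f y\<bar> \<partial>lebesgue) \<le> ennreal G" "0 \<le> G"
    and s: "0 < s"
  shows "emeasure lebesgue {x. ennreal s < frac_maximal \<alpha> f x}
    \<le> ennreal (5 ^ DIM('a) * (G powr (p - 1) * G) * s powr (- p))"
proof -
  define N where "N = density lebesgue (\<lambda>y. ennreal (G powr (p - 1)) * ennreal \<bar>f y\<bar>)"
  have N: "emeasure N B = ennreal (G powr (p - 1)) * (\<integral>\<^sup>+y\<in>B. ennreal \<bar>f y\<bar> \<partial>lebesgue)"
    if [measurable]: "B \<in> sets lebesgue" for B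
    unfolding N_def using that by (simp add: emeasure_density mult.assoc nn_integral_cmult)
  have "ennreal (s powr p) * emeasure lebesgue {x. ennreal s < frac_maximal \<alpha> f x}
      \<le> 5 ^ DIM('a) * emeasure N (space N)"
    unfolding frac_maximal_superlevel
  proof (rule emeasure_UN_balls_le)
    show "ennreal (s powr p) * emeasure lebesgue (ball c r) \<le> emeasure N (ball c r)"
      if "(c, r) \<in> {(c, r). 0 < r \<and> ennreal s < frac_mean \<alpha> f c r}" for c r
      using that frac_mean_weak_type[OF \<alpha> p G s, of r c] N[of "ball c r"] by simp
  qed (auto simp: N_def)
  also have "\<dots> \<le> 5 ^ DIM('a) * (ennreal (G powr (p - 1)) * ennreal G)"
    using G N[of UNIV] by (simp add: N_def mult_left_mono)
  also have "\<dots> = ennreal (5 ^ DIM('a) * (G powr (p - 1) * G))"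
    using G by (simp add: ennreal_mult flip: ennreal_power)
  finally have strong: "ennreal (s powr p) * emeasure lebesgue {x. ennreal s < frac_maximal \<alpha> f x}
      \<le> ennreal (5 ^ DIM('a) * (G powr (p - 1) * G))" .
  have "emeasure lebesgue {x. ennreal s < frac_maximal \<alpha> f x}
      = ennreal (s powr (- p)) *
        (ennreal (s powr p) * emeasure lebesgue {x. ennreal s < frac_maximal \<alpha> f x})"
    using s by (simp flip: mult.assoc ennreal_mult powr_add)
  also have "\<dots> \<le> ennreal (s powr (- p)) * ennreal (5 ^ DIM('a) * (G powr (p - 1) * G))"
    by (intro mult_left_mono strong) simp
  also have "\<dots> = ennreal (5 ^ DIM('a) * (G powr (p - 1) * G) * s powr (- p))"
    using G by (simp add: mult.commute flip: ennreal_mult)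
  finally show ?thesis .
qed

lemma frac_maximal_le_localized:
  fixes f :: "'a::euclidean_space \<Rightarrow> real" and \<alpha> :: real
  assumes large: "\<And>c r. 1 \<le> measure lebesgue (ball c r) \<Longrightarrow> frac_mean \<alpha> f c r \<le> K"
  obtains R' where "\<And>x. norm x < R \<Longrightarrow>
    frac_maximal \<alpha> f x \<le> K + frac_maximal \<alpha> (\<lambda>y. indicator (ball 0 R') y * f y) x"
proof -
  obtain \<rho> where \<rho>: "\<And>(c::'a) r. measure lebesgue (ball c r) \<le> 1 \<Longrightarrow> r \<le> \<rho>"
    using radius_le_of_measure_ball_le[where 'a='a and m=1] by blast
  show ?thesis
  proof (rule that[of "R + 2 * \<rho>"], rule frac_maximal_leI)
    fix x c :: 'a and r assume x: "norm x < R" and ball: "0 < r" "x \<in> ball c r"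
    let ?g = "\<lambda>y. indicator (ball 0 (R + 2 * \<rho>)) y * f y"
    show "frac_mean \<alpha> f c r \<le> K + frac_maximal \<alpha> ?g x"
    proof (cases "1 \<le> measure lebesgue (ball c r)")
      case True
      then show ?thesis
        using large by (simp add: add_increasing2)
    next
      case False
      then have "r \<le> \<rho>"
        by (intro \<rho>[of c]) simp
      have "y \<in> ball 0 (R + 2 * \<rho>)" if "y \<in> ball c r" for y
      proof -
        have "dist x y < 2 * r"
          using ball that dist_triangle3[of x y c] by (simp add: dist_commute)
        moreover have "norm y \<le> norm x + dist x y"
          using dist_triangle[of 0 y x] by simp
        ultimately show ?thesis
          using x \<open>r \<le> \<rho>\<close> by simp
      qed
      then have "ennreal \<bar>f y\<bar> * indicator (ball c r) y = ennreal \<bar>?g y\<bar> * indicator (ball c r) y" for y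
        by (auto simp: indicator_def simp del: mem_ball)
      then have "frac_mean \<alpha> f c r = frac_mean \<alpha> ?g c r"
        by (simp only: frac_mean_def)
      then show ?thesis
        using frac_mean_le_maximal[OF ball, of \<alpha> ?g] by (simp add: add_increasing)
    qed
  qed
qed

lemma frac_maximal_dominated_weak_type:
  fixes f :: "'a::euclidean_space \<Rightarrow> real" and \<alpha> :: real
  assumes f: "(\<lambda>x. ereal (f x)) \<in> L1_loc" and \<alpha>: "0 \<le> \<alpha>" "\<alpha> < DIM('a)"
    and p: "p = DIM('a) / (DIM('a) - \<alpha>)"
    and large: "\<And>c r. 1 \<le> measure lebesgue (ball c r) \<Longrightarrow> frac_mean \<alpha> f c r \<le> K"
  obtains h A where "h \<in> borel_measurable lebesgue" "0 \<le> A"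
    "\<forall>s>0. emeasure lebesgue {x. ennreal s < h x} \<le> ennreal (A * s powr (- p))"
    "\<forall>x. norm x < R \<longrightarrow> frac_maximal \<alpha> f x \<le> K + h x"
proof -
  obtain R' where R': "\<And>x. norm x < R \<Longrightarrow>
      frac_maximal \<alpha> f x \<le> K + frac_maximal \<alpha> (\<lambda>y. indicator (ball 0 R') y * f y) x"
    using frac_maximal_le_localized[OF large] by blast
  let ?g = "\<lambda>y. indicator (ball 0 R') y * f y"
  define G where "G = enn2real (\<integral>\<^sup>+y\<in>ball 0 R'. ennreal \<bar>f y\<bar> \<partial>lebesgue)"
  have "(\<integral>\<^sup>+y. ennreal \<bar>?g y\<bar> \<partial>lebesgue) = (\<integral>\<^sup>+y\<in>ball 0 R'. ennreal \<bar>f y\<bar> \<partial>lebesgue)"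
    by (intro nn_integral_cong) (auto simp: indicator_def)
  also have "\<dots> = ennreal G"
    using L1_loc_realD(2)[OF f] by (simp add: G_def)
  finally have G: "(\<integral>\<^sup>+y. ennreal \<bar>?g y\<bar> \<partial>lebesgue) \<le> ennreal G" "0 \<le> G"
    by (auto simp: G_def)
  have [measurable]: "f \<in> borel_measurable lebesgue"
    by (rule L1_loc_realD(1)[OF f])
  show ?thesis
  proof
    show "\<forall>s>0. emeasure lebesgue {x. ennreal s < frac_maximal \<alpha> ?g x}
        \<le> ennreal (5 ^ DIM('a) * (G powr (p - 1) * G) * s powr (- p))"
      by (intro allI impI frac_maximal_weak_type[OF _ \<alpha> p G]) measurable
  qed (use G R' in auto)
qed

lemma frac_maximal_finite_AE:
  fixes f :: "'a::euclidean_space \<Rightarrow> real" and \<alpha> :: real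
  assumes f: "(\<lambda>x. ereal (f x)) \<in> L1_loc" and \<alpha>: "0 \<le> \<alpha>" "\<alpha> < DIM('a)"
    and large: "\<And>c r. 1 \<le> measure lebesgue (ball c r) \<Longrightarrow> frac_mean \<alpha> f c r \<le> K" and K: "K < \<infinity>"
  shows "AE x in lebesgue. frac_maximal \<alpha> f x < \<infinity>"
proof -
  have "AE x in lebesgue. norm x < real n \<longrightarrow> frac_maximal \<alpha> f x < \<infinity>" for n
  proof -
    obtain h A where h: "h \<in> borel_measurable lebesgue" and "0 \<le> A"
      and weak_type: "\<forall>s>0. emeasure lebesgue {x. ennreal s < h x}
        \<le> ennreal (A * s powr (- (DIM('a) / (DIM('a) - \<alpha>))))"
      and le: "\<forall>x. norm x < real n \<longrightarrow> frac_maximal \<alpha> f x \<le> K + h x"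
      by (rule frac_maximal_dominated_weak_type[OF f \<alpha> refl large, where R = "real n"])
    have "AE x in lebesgue. h x < \<infinity>"
      by (rule weak_type_finite_AE[OF h, of A "DIM('a) / (DIM('a) - \<alpha>)"])
        (use weak_type \<alpha> in \<open>simp_all del: emeasure_completion\<close>)
    then show ?thesis
    proof eventually_elim
      case (elim x)
      then have "K + h x < \<infinity>"
        using K by simp
      then show ?case
        using le by (blast intro: le_less_trans)
    qed
  qed
  then have "AE x in lebesgue. \<forall>n. norm x < real n \<longrightarrow> frac_maximal \<alpha> f x < \<infinity>"
    by (subst AE_all_countable) blast
  then show ?thesis
    by eventually_elim (use reals_Archimedean2 in blast)
qed

lemma frac_maximal_locally_integrable:
  fixes f :: "'a::euclidean_space \<Rightarrow> real" and \<alpha> :: real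
  assumes f: "(\<lambda>x. ereal (f x)) \<in> L1_loc" and \<alpha>: "0 < \<alpha>" "\<alpha> < DIM('a)"
    and large: "\<And>c r. 1 \<le> measure lebesgue (ball c r) \<Longrightarrow> frac_mean \<alpha> f c r \<le> K" and K: "K < \<infinity>"
    and S: "compact S"
  shows "(\<integral>\<^sup>+x\<in>S. frac_maximal \<alpha> f x \<partial>lebesgue) < \<infinity>"
proof -
  define p where "p = DIM('a) / (DIM('a) - \<alpha>)"
  have p: "1 < p"
    using \<alpha> by (simp add: p_def)
  obtain R where R: "\<And>x. x \<in> S \<Longrightarrow> norm x < R"
    using compact_imp_bounded[OF S] by (auto simp: bounded_pos_less)
  obtain h A where h [measurable]: "h \<in> borel_measurable lebesgue" and A: "0 \<le> A"
    and weak_type: "\<forall>s>0. emeasure lebesgue {x. ennreal s < h x} \<le> ennreal (A * s powr (- p))"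
    and le: "\<forall>x. norm x < R \<longrightarrow> frac_maximal \<alpha> f x \<le> K + h x"
    by (rule frac_maximal_dominated_weak_type[OF f less_imp_le[OF \<alpha>(1)] \<alpha>(2) p_def large, where R = R])
  have S_meas [measurable]: "S \<in> sets lebesgue" and S_fin: "emeasure lebesgue S < \<infinity>"
    using lmeasurable_compact[OF S] by (auto simp: fmeasurable_def)
  have "(\<integral>\<^sup>+x\<in>S. h x \<partial>lebesgue) < \<infinity>"
    by (rule weak_type_nn_integral_finite[OF h _ p A S_meas S_fin])
      (use weak_type in \<open>simp_all del: emeasure_completion\<close>)
  have "frac_maximal \<alpha> f x * indicator S x \<le> K * indicator S x + h x * indicator S x" for x
    using le R[of x] by (simp add: indicator_def)
  then have "(\<integral>\<^sup>+x\<in>S. frac_maximal \<alpha> f x \<partial>lebesgue)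
      \<le> (\<integral>\<^sup>+x. K * indicator S x + h x * indicator S x \<partial>lebesgue)"
    by (rule nn_integral_mono)
  also have "\<dots> = K * emeasure lebesgue S + (\<integral>\<^sup>+x\<in>S. h x \<partial>lebesgue)"
    by (subst nn_integral_add) (auto simp: nn_integral_cmult)
  also have "\<dots> < \<infinity>"
    using K S_fin \<open>(\<integral>\<^sup>+x\<in>S. h x \<partial>lebesgue) < \<infinity>\<close> by (simp add: ennreal_mult_less_top)
  finally show ?thesis .
qed

section \<open>Functions of modular at most one\<close>

context
  fixes \<Phi> \<Psi> :: "real \<Rightarrow> ennreal" and \<gamma> C l :: real and f :: "'a::euclidean_space \<Rightarrow> real"
  assumes \<Phi>: "young_function \<Phi>" and \<Psi>: "young_function \<Psi>"
    and \<gamma>: "0 \<le> \<gamma>" and C: "0 < C"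
    and inverse_le: "\<And>t. 0 < t \<Longrightarrow>
      t powr (- (\<gamma> / DIM('a))) * young_inverse \<Phi> t \<le> C * young_inverse \<Psi> t"
    and f: "(\<lambda>x. ereal (f x)) \<in> L1_loc"
    and l: "0 < l" and modular: "(\<integral>\<^sup>+x. \<Phi> (\<bar>f x\<bar> / l) \<partial>lebesgue) \<le> 1"
begin

lemma modular_ball_le_1: "(\<integral>\<^sup>+y\<in>ball c r. \<Phi> (\<bar>f y\<bar> / l) \<partial>lebesgue) \<le> 1"
  using modular by (rule order_trans[rotated]) (auto intro!: nn_integral_mono simp: indicator_def)

lemma frac_mean_le_young_inverse:
  assumes r: "0 < r" and s: "0 < s" "s * measure lebesgue (ball c r) \<le> 1"
    and le: "(\<integral>\<^sup>+y\<in>ball c r. \<Phi> (\<bar>f y\<bar> / l) \<partial>lebesgue) \<le> ennreal s * emeasure lebesgue (ball c r)"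
  shows "frac_mean \<gamma> f c r \<le> ennreal (2 * C * l * young_inverse \<Psi> s)"
proof -
  define V where "V = measure lebesgue (ball c r)"
  have V: "0 < V" "emeasure lebesgue (ball c r) = ennreal V"
    unfolding V_def by (rule measure_lebesgue_ball_pos[OF r] emeasure_lebesgue_ball)+
  define e where "e = \<gamma> / DIM('a)"
  define y where "y = young_inverse \<Phi> s"
  have y: "0 \<le> y"
    unfolding y_def by (rule young_inverse_nonneg[OF \<Phi>])
  have "V powr e \<le> (1 / s) powr e"
    using V s \<gamma> by (intro powr_mono2) (auto simp: V_def e_def field_simps)
  also have "\<dots> = s powr (- e)"
    using s by (simp add: powr_minus_divide powr_divide)
  finally have V_powr_le: "V powr e \<le> s powr (- e)" .
  have "(\<integral>\<^sup>+x\<in>ball c r. ennreal \<bar>f x\<bar> \<partial>lebesgue) \<le> ennreal (2 * l * y) * emeasure lebesgue (ball c r)"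
    unfolding y_def using V le
    by (intro nn_integral_le_young_inverse_scaled[OF \<Phi> L1_loc_realD(1)[OF f] _ _ l]) auto
  then have "frac_mean \<gamma> f c r \<le> ennreal (V powr (- 1 + e)) * (ennreal (2 * l * y) * ennreal V)"
    unfolding frac_mean_def V(2) V_def[symmetric] e_def[symmetric] by (rule mult_left_mono) simp
  also have "\<dots> = ennreal (2 * l * (V powr e * y))"
    using V y l by (simp add: powr_diff flip: ennreal_mult)
  also have "\<dots> \<le> ennreal (2 * l * (s powr (- e) * y))"
    using V_powr_le y l by (intro ennreal_leI mult_left_mono mult_right_mono) auto
  also have "\<dots> \<le> ennreal (2 * l * (C * young_inverse \<Psi> s))"
    using inverse_le[OF s(1)] l by (intro ennreal_leI mult_left_mono) (auto simp: e_def y_def)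
  finally show ?thesis
    by (simp add: mult_ac)
qed

lemma frac_mean_large_ball_le:
  assumes large: "1 \<le> measure lebesgue (ball c r)"
  shows "frac_mean \<gamma> f c r \<le> ennreal (2 * C * l * young_inverse \<Psi> 1)"
proof -
  define V where "V = measure lebesgue (ball c r)"
  define s where "s = 1 / V"
  have s: "0 < s" "s \<le> 1" "s * V = 1"
    using large by (auto simp: s_def simp flip: V_def)
  have r: "0 < r"
  proof (rule ccontr)
    assume "\<not> 0 < r"
    then have "ball c r = {}"
      by simp
    with large show False
      by simp
  qed
  have "frac_mean \<gamma> f c r \<le> ennreal (2 * C * l * young_inverse \<Psi> s)"
  proof (rule frac_mean_le_young_inverse[OF r s(1)])
    have "(\<integral>\<^sup>+y\<in>ball c r. \<Phi> (\<bar>f y\<bar> / l) \<partial>lebesgue) \<le> ennreal (s * V)"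
      using modular_ball_le_1 s by simp
    then show "(\<integral>\<^sup>+y\<in>ball c r. \<Phi> (\<bar>f y\<bar> / l) \<partial>lebesgue)
        \<le> ennreal s * emeasure lebesgue (ball c r)"
      unfolding emeasure_lebesgue_ball V_def[symmetric] using s by (simp flip: ennreal_mult')
  qed (use s in \<open>simp flip: V_def\<close>)
  also have "\<dots> \<le> ennreal (2 * C * l * young_inverse \<Psi> 1)"
    using C l s young_inverse_mono[OF \<Psi>, of s 1] by (intro ennreal_leI) simp
  finally show ?thesis .
qed

lemma young_measure_ball_le_modular:
  assumes r: "0 < r" and t: "0 < t" and gt: "ennreal (2 * C * l * t) < frac_mean \<gamma> f c r"
  shows "\<Psi> t * emeasure lebesgue (ball c r) \<le> (\<integral>\<^sup>+y\<in>ball c r. \<Phi> (\<bar>f y\<bar> / l) \<partial>lebesgue)"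
    (is "_ \<le> ?A")
proof (rule ennreal_le_epsilon)
  fix \<epsilon> :: real assume \<epsilon>: "0 < \<epsilon>"
  define V where "V = measure lebesgue (ball c r)"
  have V: "0 < V" "emeasure lebesgue (ball c r) = ennreal V"
    unfolding V_def by (rule measure_lebesgue_ball_pos[OF r] emeasure_lebesgue_ball)+
  obtain a where a: "?A = ennreal a" "0 \<le> a" "a \<le> 1"
    using modular_ball_le_1[of c r] by (cases ?A) (auto simp: top_unique)
  define s where "s = min 1 (a + \<epsilon>) / V"
  have s: "0 < s" "s * V \<le> 1" "a \<le> s * V" "s * V \<le> a + \<epsilon>"
    using V a \<epsilon> by (auto simp: s_def)
  have "frac_mean \<gamma> f c r \<le> ennreal (2 * C * l * young_inverse \<Psi> s)"
    using s V by (intro frac_mean_le_young_inverse[OF r])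
      (auto simp: V_def[symmetric] a(1) intro!: ennreal_leI simp flip: ennreal_mult)
  with gt have "ennreal (2 * C * l * t) < ennreal (2 * C * l * young_inverse \<Psi> s)"
    by (rule less_le_trans)
  then have "t < young_inverse \<Psi> s"
    using C l t by (simp add: ennreal_less_iff)
  then have "\<Psi> t \<le> ennreal s"
    using t by (intro less_young_inverseD) auto
  then have "\<Psi> t * emeasure lebesgue (ball c r) \<le> ennreal s * ennreal V"
    unfolding V(2) by (rule mult_right_mono) simp
  also have "\<dots> \<le> ennreal (a + \<epsilon>)"
    using s V by (simp add: ennreal_leI flip: ennreal_mult)
  finally show "\<Psi> t * emeasure lebesgue (ball c r) \<le> ?A + ennreal \<epsilon>"
    using a \<epsilon> by simp
qed

lemma frac_maximal_weak_orlicz: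
  assumes t: "0 < t"
  shows "\<Psi> t * emeasure lebesgue {x. ennreal (2 * C * 5 ^ DIM('a) * l * t) < frac_maximal \<gamma> f x} \<le> 1"
    (is "_ * emeasure _ ?E \<le> _")
proof -
  have [measurable]: "f \<in> borel_measurable lebesgue"
    by (rule L1_loc_realD(1)[OF f])
  have "(\<lambda>x. \<Phi> \<bar>f x / l\<bar>) \<in> borel_measurable lebesgue"
    by (rule borel_measurable_young_function[OF \<Phi>]) measurable
  then have [measurable]: "(\<lambda>x. \<Phi> (\<bar>f x\<bar> / l)) \<in> borel_measurable lebesgue"
    using l by simp
  define T where "T = 5 ^ DIM('a) * t"
  have T: "0 < T" "2 * C * 5 ^ DIM('a) * l * t = 2 * C * l * T"
    using t by (auto simp: T_def)
  define N where "N = density lebesgue (\<lambda>x. \<Phi> (\<bar>f x\<bar> / l))"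
  have "\<Psi> T * emeasure lebesgue ?E \<le> 5 ^ DIM('a) * emeasure N (space N)"
    unfolding frac_maximal_superlevel T(2)
  proof (rule emeasure_UN_balls_le)
    show "\<Psi> T * emeasure lebesgue (ball c r) \<le> emeasure N (ball c r)"
      if "(c, r) \<in> {(c, r). 0 < r \<and> ennreal (2 * C * l * T) < frac_mean \<gamma> f c r}" for c r
      using that young_measure_ball_le_modular[OF _ T(1), of r c]
      by (simp add: N_def emeasure_density)
  qed (auto simp: N_def)
  also have "\<dots> \<le> 5 ^ DIM('a) * 1"
    using modular by (intro mult_left_mono) (auto simp: N_def emeasure_density)
  finally have T_le: "\<Psi> T * emeasure lebesgue ?E \<le> ennreal (5 ^ DIM('a))"
    by (simp flip: ennreal_power)
  have "\<Psi> t \<le> ennreal (1 / 5 ^ DIM('a)) * \<Psi> T"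
    using young_function_scale[OF \<Psi>, of "1 / 5 ^ DIM('a)" T] t by (simp add: T_def)
  then have "\<Psi> t * emeasure lebesgue ?E \<le> ennreal (1 / 5 ^ DIM('a)) * (\<Psi> T * emeasure lebesgue ?E)"
    unfolding mult.assoc[symmetric] by (rule mult_right_mono) simp
  also have "\<dots> \<le> ennreal (1 / 5 ^ DIM('a)) * ennreal (5 ^ DIM('a))"
    by (intro mult_left_mono T_le) simp
  also have "\<dots> = 1"
    by (simp flip: ennreal_mult)
  finally show ?thesis .
qed

lemma frac_maximal_orlicz_finite_AE:
  assumes "0 \<le> \<alpha>" "\<alpha> \<le> \<gamma>" "\<alpha> < DIM('a)"
  shows "AE x in lebesgue. frac_maximal \<alpha> f x < \<infinity>"
proof (rule frac_maximal_finite_AE[OF f])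
  show "frac_mean \<alpha> f c r \<le> ennreal (2 * C * l * young_inverse \<Psi> 1)"
    if "1 \<le> measure lebesgue (ball c r)" for c r
    using frac_mean_mono_order[OF that \<open>\<alpha> \<le> \<gamma>\<close>] frac_mean_large_ball_le[OF that]
    by (rule order_trans)
qed (use assms in auto)

lemma frac_maximal_orlicz_locally_integrable:
  assumes "0 < \<gamma>" "\<gamma> < DIM('a)" "compact S"
  shows "(\<integral>\<^sup>+x\<in>S. frac_maximal \<gamma> f x \<partial>lebesgue) < \<infinity>"
  by (rule frac_maximal_locally_integrable[OF f assms(1,2) frac_mean_large_ball_le _ assms(3)]) auto

end

section \<open>Boundedness between Orlicz spaces\<close>

lemma L1_locI_dominated:
  assumes g: "g \<in> borel_measurable lebesgue" and h [measurable]: "h \<in> borel_measurable lebesgue"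
    and dominated: "AE x in lebesgue. e2ennreal \<bar>g x\<bar> \<le> ennreal c * h x"
    and h_loc: "\<And>S. compact S \<Longrightarrow> (\<integral>\<^sup>+x\<in>S. h x \<partial>lebesgue) < \<infinity>"
  shows "g \<in> L1_loc"
  unfolding L1_loc_def
proof (intro CollectI conjI allI impI)
  fix S :: "'a set" assume S: "compact S"
  then have [measurable]: "S \<in> sets lebesgue"
    by (intro lmeasurable_compact fmeasurableD)
  have "(\<integral>\<^sup>+x\<in>S. e2ennreal \<bar>g x\<bar> \<partial>lebesgue) \<le> (\<integral>\<^sup>+x. ennreal c * (h x * indicator S x) \<partial>lebesgue)"
    using dominated by (intro nn_integral_mono_AE) (auto elim!: eventually_mono simp: indicator_def)
  also have "\<dots> = ennreal c * (\<integral>\<^sup>+x\<in>S. h x \<partial>lebesgue)"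
    by (rule nn_integral_cmult) measurable
  also have "\<dots> < \<infinity>"
    using h_loc[OF S] by (simp add: ennreal_mult_less_top)
  finally show "(\<integral>\<^sup>+x\<in>S. e2ennreal \<bar>g x\<bar> \<partial>lebesgue) < \<infinity>" .
qed (rule g)

lemma ereal_less_divide_abs_imp:
  assumes "0 < m" "0 \<le> t" "ereal t < \<bar>y\<bar> / ereal m"
  shows "ennreal (m * t) < e2ennreal \<bar>y\<bar>"
proof (cases y)
  case (real u)
  then have "m * t < \<bar>u\<bar>"
    using assms by (simp add: pos_less_divide_eq mult.commute)
  then show ?thesis
    using assms by (simp add: real ennreal_less_iff)
qed simp_all

lemma weak_orlicz_norm_le_dominated:
  fixes g :: "'a::euclidean_space \<Rightarrow> ereal"
  assumes h [measurable]: "h \<in> borel_measurable lebesgue"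
    and dominated: "AE x in lebesgue. e2ennreal \<bar>g x\<bar> \<le> ennreal c * h x"
    and pos: "0 < c" "0 < k"
    and weak: "\<And>t. 0 < t \<Longrightarrow> \<Psi> t * emeasure lebesgue {x. ennreal (k * t) < h x} \<le> 1"
  shows "weak_orlicz_norm \<Psi> g \<le> ennreal (c * k)"
  unfolding weak_orlicz_norm_def
proof (rule Inf_lower, rule CollectI, intro exI conjI SUP_least)
  fix t :: real assume "t \<in> {0<..}"
  then have t: "0 < t" by simp
  have "AE x in lebesgue. \<bar>g x\<bar> / ereal (c * k) > ereal t \<longrightarrow> ennreal (k * t) < h x"
    using dominated
  proof eventually_elim
    case (elim x)
    show ?case
    proof
      assume "\<bar>g x\<bar> / ereal (c * k) > ereal t"
      then have "ennreal (c * k * t) < e2ennreal \<bar>g x\<bar>"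
        using pos t by (intro ereal_less_divide_abs_imp) auto
      also note elim
      finally have "ennreal c * ennreal (k * t) < ennreal c * h x"
        using pos t by (simp add: mult.assoc flip: ennreal_mult)
      then show "ennreal (k * t) < h x"
        using mult_left_mono[of "h x" "ennreal (k * t)" "ennreal c"] by (auto simp: not_less[symmetric])
    qed
  qed
  moreover have "{x \<in> space lebesgue. ennreal (k * t) < h x} \<in> sets lebesgue"
    by measurable
  ultimately have "emeasure lebesgue {x. \<bar>g x\<bar> / ereal (c * k) > ereal t}
      \<le> emeasure lebesgue {x. ennreal (k * t) < h x}"
    by (intro emeasure_mono_AE) simp_all
  then have "\<Psi> t * emeasure lebesgue {x. \<bar>g x\<bar> / ereal (c * k) > ereal t}
      \<le> \<Psi> t * emeasure lebesgue {x. ennreal (k * t) < h x}"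
    by (rule mult_left_mono) simp
  also note weak[OF t]
  finally show "\<Psi> t * emeasure lebesgue {x. \<bar>g x\<bar> / ereal (c * k) > ereal t} \<le> 1" .
qed (use pos in auto)

lemma orlicz_space_modular_le_1:
  assumes \<Phi>: "young_function \<Phi>" and f: "f \<in> orlicz_space \<Phi>"
  obtains l where "0 < l" "(\<integral>\<^sup>+x. \<Phi> (\<bar>f x\<bar> / l) \<partial>lebesgue) \<le> 1"
proof -
  obtain k where k: "0 < k" and fin: "(\<integral>\<^sup>+x. \<Phi> (k * \<bar>f x\<bar>) \<partial>lebesgue) < \<infinity>"
    using f by (auto simp: orlicz_space_def)
  obtain J where J: "(\<integral>\<^sup>+x. \<Phi> (k * \<bar>f x\<bar>) \<partial>lebesgue) = ennreal J" "0 \<le> J"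
    using fin by (cases "\<integral>\<^sup>+x. \<Phi> (k * \<bar>f x\<bar>) \<partial>lebesgue") auto
  have [measurable]: "f \<in> borel_measurable lebesgue"
    using f by (intro L1_loc_realD(1)) (simp add: orlicz_space_def)
  have "(\<lambda>x. \<Phi> \<bar>k * f x\<bar>) \<in> borel_measurable lebesgue"
    by (rule borel_measurable_young_function[OF \<Phi>]) measurable
  then have [measurable]: "(\<lambda>x. \<Phi> (k * \<bar>f x\<bar>)) \<in> borel_measurable lebesgue"
    using k by (simp add: abs_mult)
  define u where "u = 1 / (J + 1)"
  have u: "0 < u" "u \<le> 1" "u * J \<le> 1"
    using J by (auto simp: u_def field_simps)
  show ?thesis
  proof
    show "0 < 1 / (u * k)" using u k by simp
    have "\<Phi> (\<bar>f x\<bar> / (1 / (u * k))) \<le> ennreal u * \<Phi> (k * \<bar>f x\<bar>)" for x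
      using young_function_scale[OF \<Phi>, of u "k * \<bar>f x\<bar>"] u k by (simp add: mult_ac)
    then have "(\<integral>\<^sup>+x. \<Phi> (\<bar>f x\<bar> / (1 / (u * k))) \<partial>lebesgue)
        \<le> (\<integral>\<^sup>+x. ennreal u * \<Phi> (k * \<bar>f x\<bar>) \<partial>lebesgue)"
      by (rule nn_integral_mono)
    also have "\<dots> = ennreal (u * J)"
      using u J by (simp add: nn_integral_cmult ennreal_mult)
    also have "\<dots> \<le> 1"
      using u by (simp add: ennreal_le_1)
    finally show "(\<integral>\<^sup>+x. \<Phi> (\<bar>f x\<bar> / (1 / (u * k))) \<partial>lebesgue) \<le> 1" .
  qed
qed

lemma bounded_operator_orliczI:
  fixes T :: "('a::euclidean_space \<Rightarrow> real) \<Rightarrow> 'g"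
  assumes \<Phi>: "young_function \<Phi>" and C: "0 < C"
    and bound: "\<And>f l. \<lbrakk>(\<lambda>x. ereal (f x)) \<in> L1_loc; 0 < l; (\<integral>\<^sup>+x. \<Phi> (\<bar>f x\<bar> / l) \<partial>lebesgue) \<le> 1\<rbrakk> \<Longrightarrow>
      T f \<in> Y \<and> norm_Y (T f) \<le> ennreal (C * l)"
  shows "bounded_operator (orlicz_space \<Phi>) (orlicz_norm \<Phi>) Y norm_Y T"
  unfolding bounded_operator_def
proof (intro exI conjI ballI)
  fix f :: "'a \<Rightarrow> real" assume f: "f \<in> orlicz_space \<Phi>"
  then have f_loc: "(\<lambda>x. ereal (f x)) \<in> L1_loc"
    by (simp add: orlicz_space_def)
  show "T f \<in> Y"
    using orlicz_space_modular_le_1[OF \<Phi> f] bound[OF f_loc] by blast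
  have "norm_Y (T f) / ennreal C \<le> orlicz_norm \<Phi> f"
    unfolding orlicz_norm_def
  proof (rule Inf_greatest, clarify)
    fix l :: real assume l: "0 < l" "(\<integral>\<^sup>+x. \<Phi> (\<bar>f x\<bar> / l) \<partial>lebesgue) \<le> 1"
    have "norm_Y (T f) / ennreal C \<le> ennreal (C * l) / ennreal C"
      using bound[OF f_loc l] by (intro divide_right_mono_ennreal) simp
    also have "\<dots> = ennreal l"
      using C l by (simp add: divide_ennreal)
    finally show "norm_Y (T f) / ennreal C \<le> ennreal l" .
  qed
  then have "ennreal C * (norm_Y (T f) / ennreal C) \<le> ennreal C * orlicz_norm \<Phi> f"
    by (rule mult_left_mono) simp
  then show "norm_Y (T f) \<le> ennreal C * orlicz_norm \<Phi> f"
    using C by (simp add: ennreal_times_divide ennreal_mult_divide_eq mult.commute[of _ "norm_Y (T f)"])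
qed (use C in simp)

lemma max_commutator_weak_orlicz_bound:
  fixes b f :: "'a::euclidean_space \<Rightarrow> real" and \<alpha> \<beta> :: real
  assumes \<Phi>: "young_function \<Phi>" and \<Psi>: "young_function \<Psi>"
    and \<alpha>: "0 \<le> \<alpha>" and \<beta>: "0 < \<beta>" and lt_dim: "\<alpha> + \<beta> < DIM('a)" and C: "0 < C"
    and inverse_le: "\<And>t. 0 < t \<Longrightarrow>
      t powr (- ((\<alpha> + \<beta>) / DIM('a))) * young_inverse \<Phi> t \<le> C * young_inverse \<Psi> t"
    and b [measurable]: "b \<in> borel_measurable lebesgue" and b_nonneg: "\<And>x. 0 \<le> b x" and L: "0 < L"
    and osc: "\<And>c r x y. \<lbrakk>0 < r; x \<in> ball c r; y \<in> ball c r\<rbrakk> \<Longrightarrow>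
      \<bar>b x - b y\<bar> \<le> L * measure lebesgue (ball c r) powr (\<beta> / DIM('a))"
    and f: "(\<lambda>x. ereal (f x)) \<in> L1_loc" and l: "0 < l"
    and modular: "(\<integral>\<^sup>+x. \<Phi> (\<bar>f x\<bar> / l) \<partial>lebesgue) \<le> 1"
  shows "max_commutator \<alpha> b f \<in> weak_orlicz_space \<Psi> \<and>
    weak_orlicz_norm \<Psi> (max_commutator \<alpha> b f) \<le> ennreal (L * (2 * C * 5 ^ DIM('a) * l))"
proof -
  define \<gamma> where "\<gamma> = \<alpha> + \<beta>"
  have \<gamma>: "0 < \<gamma>" "0 \<le> \<gamma>" "\<alpha> \<le> \<gamma>" "\<gamma> < DIM('a)" "\<alpha> < DIM('a)"
    using \<alpha> \<beta> lt_dim by (auto simp: \<gamma>_def)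
  have f_meas [measurable]: "f \<in> borel_measurable lebesgue"
    by (rule L1_loc_realD(1)[OF f])
  note hyps = \<Phi> \<Psi> \<gamma>(2) C inverse_le[folded \<gamma>_def] f l modular
  have "AE x in lebesgue. frac_maximal \<alpha> f x < \<infinity>"
    by (rule frac_maximal_orlicz_finite_AE[OF hyps \<alpha> \<gamma>(3,5)])
  then have dominated:
      "AE x in lebesgue. e2ennreal \<bar>max_commutator \<alpha> b f x\<bar> \<le> ennreal L * frac_maximal \<gamma> f x"
    unfolding \<gamma>_def by eventually_elim (rule abs_max_commutator_le[OF b f_meas b_nonneg L osc])
  have "max_commutator \<alpha> b f \<in> L1_loc"
  proof (rule L1_locI_dominated[OF _ _ dominated])
    show "max_commutator \<alpha> b f \<in> borel_measurable lebesgue"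
      unfolding max_commutator_def[abs_def] by measurable
    show "(\<integral>\<^sup>+x\<in>S. frac_maximal \<gamma> f x \<partial>lebesgue) < \<infinity>" if "compact S" for S
      by (rule frac_maximal_orlicz_locally_integrable[OF hyps \<gamma>(1,4) that])
  qed measurable
  moreover have
      "weak_orlicz_norm \<Psi> (max_commutator \<alpha> b f) \<le> ennreal (L * (2 * C * 5 ^ DIM('a) * l))"
    by (rule weak_orlicz_norm_le_dominated[OF _ dominated L _ frac_maximal_weak_orlicz[OF hyps]])
      (use C l in auto)
  ultimately show ?thesis
    by (auto simp: weak_orlicz_space_def intro: le_less_trans)
qed

theorem theorem4p19:
  fixes b :: "real ^ 'n \<Rightarrow> real" and \<alpha> \<beta> :: real and \<Phi> \<Psi> :: "real \<Rightarrow> ennreal"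
  assumes "\<And>x. 0 \<le> b x"
    and "(\<lambda>x. ereal (b x)) \<in> L1_loc"
    and "0 < \<beta>" and "\<beta> < 1"
    and "0 \<le> \<alpha>" and "\<alpha> < real CARD('n)"
    and "0 < \<alpha> + \<beta>" and "\<alpha> + \<beta> < real CARD('n)"
    and "b \<in> lipschitz_space \<beta>"
    and "young_function \<Phi>" and "young_function \<Psi>"
    and "\<Phi> \<in> young_class_Y"
    and "\<exists>C>0. \<forall>t>0. t powr (- ((\<alpha> + \<beta>) / real CARD('n))) * young_inverse \<Phi> t
                       \<le> C * young_inverse \<Psi> t"
  shows "bounded_operator (orlicz_space \<Phi>) (orlicz_norm \<Phi>)
           (weak_orlicz_space \<Psi>) (weak_orlicz_norm \<Psi>) (max_commutator \<alpha> b)"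
proof -
  obtain C where C: "0 < C" and inverse_le: "\<And>t. 0 < t \<Longrightarrow>
      t powr (- ((\<alpha> + \<beta>) / DIM(real ^ 'n))) * young_inverse \<Phi> t \<le> C * young_inverse \<Psi> t"
    using assms(13) by auto
  obtain L where L: "0 < L" and osc: "\<And>c r x y. \<lbrakk>0 < r; x \<in> ball c r; y \<in> ball c r\<rbrakk> \<Longrightarrow>
      \<bar>b x - b y\<bar> \<le> L * measure lebesgue (ball c r) powr (\<beta> / DIM(real ^ 'n))"
    using lipschitz_space_oscillation_ball[OF \<open>b \<in> lipschitz_space \<beta>\<close> \<open>0 < \<beta>\<close>] by blast
  have b: "b \<in> borel_measurable lebesgue"
    using assms(2) by (rule L1_loc_realD)
  have lt_dim: "\<alpha> + \<beta> < DIM(real ^ 'n)"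
    using \<open>\<alpha> + \<beta> < real CARD('n)\<close> by simp
  show ?thesis
  proof (rule bounded_operator_orliczI[OF \<open>young_function \<Phi>\<close>])
    show "0 < L * (2 * C * 5 ^ DIM(real ^ 'n))"
      using L C by simp
  next
    fix f :: "real ^ 'n \<Rightarrow> real" and l :: real
    assume "(\<lambda>x. ereal (f x)) \<in> L1_loc" "0 < l" "(\<integral>\<^sup>+x. \<Phi> (\<bar>f x\<bar> / l) \<partial>lebesgue) \<le> 1"
    from max_commutator_weak_orlicz_bound[OF \<open>young_function \<Phi>\<close> \<open>young_function \<Psi>\<close> \<open>0 \<le> \<alpha>\<close> \<open>0 < \<beta>\<close>
        lt_dim C inverse_le b \<open>\<And>x. 0 \<le> b x\<close> L osc this]
    show "max_commutator \<alpha> b f \<in> weak_orlicz_space \<Psi> \<and>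
        weak_orlicz_norm \<Psi> (max_commutator \<alpha> b f) \<le> ennreal (L * (2 * C * 5 ^ DIM(real ^ 'n)) * l)"
      by (simp add: mult.assoc)
  qed
qed

end
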